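(* Let $\mathcal{S}$ be a balanced and irreducible system of $\mathbb{Z}$-equations. Assume $\mathcal{S}$ admits a sequence of dominant reductions terminating with $\emptyset(1)$: \[ \mathcal{S}=\mathcal{S}^{(0)}\rightsquigarrow\mathcal{S}^{(1)}\rightsquigarrow\cdots\rightsquigarrow\mathcal{S}^{(k)}\rightsquigarrow\emptyset(1), \] and let $\tilde b$ be the maximum of the dominant coefficients of the dominant subsystems used in this sequence. Then for every prime $p>\tilde b$ and every $\epsilon>0$ there exists $n_0=n_0(p,\epsilon)$ such that for every $n\geq n_0$, \[ \mathrm{ex}_{\mathcal{S}}(n,p)\geq\left((1-\epsilon)\left\lfloor\frac{p+\tilde b-1}{\tilde b}\right\rfloor\right)^n . \]
   Context: A $\mathbb{Z}$-equation $\sum_ib_ix_i=0$ is balanced if $\sum_ib_i=0$; a balanced equation is dominant if there is $j$ with $b_j>0$ and $b_i\leq0$ ($i\neq j$), or $b_j<0$ and $b_i\geq0$ ($i\neq j$); its dominant coefficient is $|b_j|$. A system is balanced/dominant if all its equations are; the dominant coefficient of a dominant system is the maximum over its equations. A subsystem is a nonempty subcollection of equations. For a system in variables $x_1,\dots,x_r$, let $e_l$ be the set of indices with nonzero coefficient in equation $l$; the associated hypergraph has edges $e_l$ and vertex set $J=\bigcup_l e_l$; the system is irreducible if $J=[r]$ and this hypergraph is connected. Dominant reduction: given a balanced system $\mathcal{S}$ in variables $x_1,\dots,x_r$ and a dominant subsystem $\mathcal{S}'$ with hypergraph vertex set $J_{\mathcal{S}'}$, the new system $\mathcal{S}^{(1)}$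 has variables $x_i$ for $i\in[r]\setminus J_{\mathcal{S}'}$ together with one variable $x_K$ for each connected component $K$ of the hypergraph of $\mathcal{S}'$; its equations are obtained from each equation of $\mathcal{S}$ by replacing $x_i$ by $x_K$ for every $i\in K$ (collecting coefficients) and keeping other terms, discarding any equation that becomes the trivial equation $0=0$. Then $\mathcal{S}\rightsquigarrow\mathcal{S}^{(1)}$. $\emptyset(1)$ denotes the empty system of equations in one variable. For a prime $p$, $\mathcal{S}(p)$ is the mod $p$ reduction; $A\subseteq\mathbb{F}_p^n$ is strongly $\mathcal{S}(p)$-free if every solution $(x_1,\dots,x_r)\in A^r$ of $\mathcal{S}(p)$ has $x_1=\cdots=x_r$, and $\mathrm{ex}_{\mathcal{S}}(n,p)$ is the maximum size of such $A$.
   Formalization: The formal theorem assumes 0 < ε ≤ 1 instead of every ε > 0; for large ε the printed inequality fails at even n (e.g. x₁+x₂−2x₃=0, p=3, ε=5 would need ex ≥ 8^n although ex ≤ 3^n). *)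

theory Defs
  imports Complex_Main "HOL-Number_Theory.Number_Theory" "HOL-Library.FuncSet"
begin

text \<open>
  An equation is its coefficient function, with value 0 off the variables of the system.
  Repeated equations are identified: they affect neither the solutions, nor the hypergraph,
  nor the reductions below.
\<close>

record lin_system =
  vars :: "nat set"
  eqs :: "(nat \<Rightarrow> int) set"

definition wf_system :: "lin_system \<Rightarrow> bool" where
  "wf_system S \<longleftrightarrow> finite (vars S) \<and> finite (eqs S) \<and> (\<forall>b\<in>eqs S. \<forall>i. i \<notin> vars S \<longrightarrow> b i = 0)"

definition balanced_eq :: "nat set \<Rightarrow> (nat \<Rightarrow> int) \<Rightarrow> bool" where
  "balanced_eq V b \<longleftrightarrow> (\<Sum>i\<in>V. b i) = 0"

definition balanced :: "lin_system \<Rightarrow> bool" where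
  "balanced S \<longleftrightarrow> (\<forall>b\<in>eqs S. balanced_eq (vars S) b)"

definition dominant_index :: "nat set \<Rightarrow> (nat \<Rightarrow> int) \<Rightarrow> nat \<Rightarrow> bool" where
  "dominant_index V b j \<longleftrightarrow> j \<in> V \<and>
     (b j > 0 \<and> (\<forall>i\<in>V - {j}. b i \<le> 0) \<or> b j < 0 \<and> (\<forall>i\<in>V - {j}. b i \<ge> 0))"

definition dominant_eq :: "nat set \<Rightarrow> (nat \<Rightarrow> int) \<Rightarrow> bool" where
  "dominant_eq V b \<longleftrightarrow> balanced_eq V b \<and> (\<exists>j. dominant_index V b j)"

definition dominant :: "lin_system \<Rightarrow> bool" where
  "dominant S \<longleftrightarrow> (\<forall>b\<in>eqs S. dominant_eq (vars S) b)"

text \<open>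
  The dominant index need not be unique (as in \<open>a x\<^sub>1 - a x\<^sub>2 = 0\<close>), but for a balanced equation
  the value \<open>\<bar>b j\<bar>\<close> is.
\<close>

definition dominant_coeff_eq :: "nat set \<Rightarrow> (nat \<Rightarrow> int) \<Rightarrow> nat" where
  "dominant_coeff_eq V b = (THE c. \<exists>j. dominant_index V b j \<and> c = nat \<bar>b j\<bar>)"

definition dominant_coeff :: "lin_system \<Rightarrow> nat" where
  "dominant_coeff S = Max (dominant_coeff_eq (vars S) ` eqs S)"

definition subsystem :: "lin_system \<Rightarrow> lin_system \<Rightarrow> bool" where
  "subsystem T S \<longleftrightarrow> vars T = vars S \<and> eqs T \<subseteq> eqs S \<and> eqs T \<noteq> {}"

definition edge :: "lin_system \<Rightarrow> (nat \<Rightarrow> int) \<Rightarrow> nat set" where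
  "edge S b = {i \<in> vars S. b i \<noteq> 0}"

definition hyp_verts :: "lin_system \<Rightarrow> nat set" where
  "hyp_verts S = (\<Union>b\<in>eqs S. edge S b)"

definition hyp_adj :: "lin_system \<Rightarrow> (nat \<times> nat) set" where
  "hyp_adj S = {(i, j). \<exists>b\<in>eqs S. i \<in> edge S b \<and> j \<in> edge S b}"

text \<open>The connected component of a vertex \<open>i\<close> of the hypergraph.\<close>

definition component :: "lin_system \<Rightarrow> nat \<Rightarrow> nat set" where
  "component S i = {j. (i, j) \<in> (hyp_adj S)\<^sup>*}"

definition hyp_connected :: "lin_system \<Rightarrow> bool" where
  "hyp_connected S \<longleftrightarrow> (\<forall>i\<in>hyp_verts S. \<forall>j\<in>hyp_verts S. j \<in> component S i)"

definition irreducible_system :: "lin_system \<Rightarrow> bool" where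
  "irreducible_system S \<longleftrightarrow> hyp_verts S = vars S \<and> hyp_connected S"

text \<open>
  The variable \<open>x\<^sub>K\<close> belonging to a component \<open>K\<close> is named by the least index in \<open>K\<close>; this index lies
  in \<open>hyp_verts T\<close>, so it never clashes with one of the variables that are kept.
\<close>

definition new_var :: "lin_system \<Rightarrow> nat \<Rightarrow> nat" where
  "new_var T i = (if i \<in> hyp_verts T then Min (component T i) else i)"

definition reduce_eq :: "lin_system \<Rightarrow> (nat \<Rightarrow> int) \<Rightarrow> nat \<Rightarrow> int" where
  "reduce_eq T b v = (\<Sum>i | i \<in> vars T \<and> new_var T i = v. b i)"

definition reduce :: "lin_system \<Rightarrow> lin_system \<Rightarrow> lin_system" where
  "reduce S T = \<lparr>vars = new_var T ` vars S, eqs = reduce_eq T ` eqs S - {\<lambda>_. 0}\<rparr>"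

definition dominant_reduction :: "lin_system \<Rightarrow> lin_system \<Rightarrow> lin_system \<Rightarrow> bool" where
  "dominant_reduction S T S' \<longleftrightarrow> balanced S \<and> subsystem T S \<and> dominant T \<and> S' = reduce S T"

text \<open>\<open>\<emptyset>(1)\<close>; the name of the single variable is irrelevant.\<close>

definition empty_system_one :: "lin_system \<Rightarrow> bool" where
  "empty_system_one S \<longleftrightarrow> card (vars S) = 1 \<and> eqs S = {}"

text \<open>The elements of \<open>F\<^sub>p\<close> are represented by the residues \<open>0, \<dots>, p - 1\<close>.\<close>

definition Fp_space :: "nat \<Rightarrow> nat \<Rightarrow> (nat \<Rightarrow> int) set" where
  "Fp_space p n = {..<n} \<rightarrow>\<^sub>E {0..<int p}"

definition solution_mod :: "lin_system \<Rightarrow> nat \<Rightarrow> nat \<Rightarrow> (nat \<Rightarrow> nat \<Rightarrow> int) \<Rightarrow> bool" where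
  "solution_mod S p n x \<longleftrightarrow>
     (\<forall>b\<in>eqs S. \<forall>t<n. [(\<Sum>i\<in>vars S. b i * x i t) = 0] (mod int p))"

definition strongly_free :: "lin_system \<Rightarrow> nat \<Rightarrow> nat \<Rightarrow> (nat \<Rightarrow> int) set \<Rightarrow> bool" where
  "strongly_free S p n A \<longleftrightarrow>
     (\<forall>x. (\<forall>i\<in>vars S. x i \<in> A) \<and> solution_mod S p n x \<longrightarrow>
          (\<forall>i\<in>vars S. \<forall>j\<in>vars S. x i = x j))"

definition ex_size :: "lin_system \<Rightarrow> nat \<Rightarrow> nat \<Rightarrow> nat" where
  "ex_size S n p = Max (card ` {A. A \<subseteq> Fp_space p n \<and> strongly_free S p n A})"

end

theory Submission imports Defs
begin

text \<open>
  Let \<open>m = (p - 1) div b\<close>. For digits in \<open>{0..m}\<close> a dominant equation whose dominant coefficient is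
  at most \<open>b\<close> has no wrap-around modulo \<open>p\<close>, so it holds over the integers and expresses one
  variable as a convex combination of the others. On a sphere strict convexity makes all variables
  of the equation equal; hence solutions are constant on the components of a dominant subsystem and
  descend to the reduced system. Some sphere in \<open>{0..m}\<^sup>n\<close> has at least
  \<open>(m + 1)\<^sup>n / (n m\<^sup>2 + 1)\<close> points, and the denominator is absorbed by \<open>(1 - \<epsilon>)\<^sup>n\<close>.
\<close>

section \<open>Pigeonhole on integer spheres\<close>

text \<open>\<open>R\<close> is the squared radius, taken over the integers and not modulo
  \<open>p\<close>. Points are extensional functions, as in \<open>Fp_space\<close>.\<close>

definition grid_sphere :: "nat \<Rightarrow> nat \<Rightarrow> int \<Rightarrow> (nat \<Rightarrow> int) set" where
  "grid_sphere m n R = {f \<in> {..<n} \<rightarrow>\<^sub>E {0..int m}. (\<Sum>t<n. (f t)\<^sup>2) = R}"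

text \<open>Pigeonhole: the squared norm of a grid point is one of the n m^2 + 1 integers from 0 to
  n m^2, so some value is attained at least the average number of times.\<close>

lemma large_grid_sphere:
  "\<exists>R. (m + 1) ^ n \<le> card (grid_sphere m n R) * (n * m\<^sup>2 + 1)"
proof -
  define D where "D = ({..<n} \<rightarrow>\<^sub>E {0..int m})"
  define q where "q f = (\<Sum>t<n. (f t)\<^sup>2)" for f :: "nat \<Rightarrow> int"
  define B where "B = {0..int (n * m\<^sup>2)}"
  have fin: "finite D" unfolding D_def by (intro finite_PiE) auto
  have cD: "card D = (m + 1) ^ n" unfolding D_def by (simp add: card_PiE nat_add_distrib)
  have q: "q f \<in> B" if "f \<in> D" for f
  proof -
    have "(f t)\<^sup>2 \<le> (int m)\<^sup>2" if "t < n" for t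
      using \<open>f \<in> D\<close> that by (intro power_mono) (auto simp: D_def PiE_iff)
    then have "q f \<le> (\<Sum>t<n. (int m)\<^sup>2)" unfolding q_def by (intro sum_mono) auto
    moreover have "q f \<ge> 0" unfolding q_def by (intro sum_nonneg) auto
    ultimately show ?thesis by (simp add: B_def)
  qed
  have fib: "grid_sphere m n R = {f \<in> D. q f = R}" for R
    by (simp add: grid_sphere_def D_def q_def)
  show ?thesis
  proof (rule ccontr)
    assume "\<not> ?thesis"
    then have less: "card {f \<in> D. q f = R} * (n * m\<^sup>2 + 1) < card D" for R
      by (simp add: cD not_le fib)
    have "card D = (\<Sum>R\<in>B. card {f \<in> D. q f = R})"
      using sum.group[of D B q "\<lambda>_. 1::nat"] fin q by (simp add: B_def image_subset_iff)
    then have "card D * (n * m\<^sup>2 + 1) = (\<Sum>R\<in>B. card {f \<in> D. q f = R} * (n * m\<^sup>2 + 1))"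
      by (simp only: sum_distrib_right)
    also have "\<dots> < (\<Sum>R\<in>B. card D)"
      using less by (intro sum_strict_mono) (auto simp: B_def)
    also have "\<dots> = card D * (n * m\<^sup>2 + 1)" by (simp add: B_def nat_add_distrib flip: of_nat_mult of_nat_power)
    finally show False by simp
  qed
qed

section \<open>Limit and floor estimates\<close>

text \<open>Pays for the pigeonhole loss: n q^n tends to 0 when |q| < 1.\<close>

lemma eventually_power_times_linear_le_1:
  fixes \<epsilon> c :: real
  assumes "0 < \<epsilon>" "\<epsilon> \<le> 1"
  shows "\<exists>n0. \<forall>n\<ge>n0. (1 - \<epsilon>) ^ n * (real n * c + 1) \<le> 1"
proof -
  have n: "norm (1 - \<epsilon>) < 1" using assms by simp
  have "(\<lambda>n. c * (of_nat n * (1 - \<epsilon>) ^ n) + (1 - \<epsilon>) ^ n) \<longlonglongrightarrow> c * 0 + 0"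
    by (intro tendsto_intros powser_times_n_limit_0 LIMSEQ_power_zero n)
  then have "eventually (\<lambda>n. c * (of_nat n * (1 - \<epsilon>) ^ n) + (1 - \<epsilon>) ^ n < 1) sequentially"
    by (rule order_tendstoD) simp
  then show ?thesis
    unfolding eventually_sequentially by (force simp: algebra_simps intro: less_imp_le)
qed

text \<open>Identifies the floor in the theorem with the number of digits in
  \<open>{0..m}\<close>.\<close>

lemma floor_div_eq:
  assumes "b > 0" "p > 0"
  shows "\<lfloor>(real p + real b - 1) / real b\<rfloor> = int ((p - 1) div b + 1)"
proof -
  have "real p + real b - 1 = real (p - 1 + b)" using assms by simp
  then have "\<lfloor>(real p + real b - 1) / real b\<rfloor> = int ((p - 1 + b) div b)"
    by (simp only: floor_divide_of_nat_eq of_nat_eq_iff)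
  also have "(p - 1 + b) div b = (p - 1) div b + 1"
    using assms(1) by simp
  finally show ?thesis .
qed

section \<open>Dominant equations over the integers\<close>

text \<open>The coefficients off \<open>j\<close> vanish or have the sign opposite to
  \<open>b j\<close>, and all coefficients sum to 0.\<close>

lemma balanced_sum_abs_eq:
  assumes "finite V" "balanced_eq V b" "dominant_index V b j"
  shows "(\<Sum>i\<in>V - {j}. \<bar>b i\<bar>) = \<bar>b j\<bar>"
proof -
  have j: "j \<in> V" using assms(3) by (simp add: dominant_index_def)
  have s: "b j + (\<Sum>i\<in>V - {j}. b i) = 0"
    using assms(2) sum.remove[OF assms(1) j, of b] by (simp add: balanced_eq_def)
  from assms(3) consider "b j > 0" "\<forall>i\<in>V - {j}. b i \<le> 0" | "b j < 0" "\<forall>i\<in>V - {j}. b i \<ge> 0"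
    unfolding dominant_index_def by blast
  then show ?thesis
  proof cases
    case 1
    then have "(\<Sum>i\<in>V - {j}. \<bar>b i\<bar>) = (\<Sum>i\<in>V - {j}. - b i)" by (intro sum.cong) auto
    then show ?thesis using 1 s by (simp add: sum_negf)
  next
    case 2
    then have "(\<Sum>i\<in>V - {j}. \<bar>b i\<bar>) = (\<Sum>i\<in>V - {j}. b i)" by (intro sum.cong) auto
    then show ?thesis using 2 s by simp
  qed
qed

text \<open>Justifies the \<open>THE\<close> in the definition: for two distinct dominant indices,
  the absolute value at each is a summand of a sum equal to the absolute value at the other.\<close>

lemma dominant_coeff_eq_eq:
  assumes "finite V" "balanced_eq V b" "dominant_index V b j"
  shows "dominant_coeff_eq V b = nat \<bar>b j\<bar>"
proof -
  have le: "\<bar>b i\<bar> \<le> \<bar>b i'\<bar>" if "dominant_index V b i" "dominant_index V b i'" for i i'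
  proof (cases "i = i'")
    case False
    then have "i \<in> V - {i'}" using that by (simp add: dominant_index_def)
    then have "\<bar>b i\<bar> \<le> (\<Sum>i\<in>V - {i'}. \<bar>b i\<bar>)" using assms(1) by (intro member_le_sum) auto
    then show ?thesis using balanced_sum_abs_eq[OF assms(1,2) that(2)] by simp
  qed simp
  show ?thesis unfolding dominant_coeff_eq_def
  proof (rule the_equality)
    show "\<exists>i. dominant_index V b i \<and> nat \<bar>b j\<bar> = nat \<bar>b i\<bar>" using assms(3) by blast
    show "c = nat \<bar>b j\<bar>" if "\<exists>i. dominant_index V b i \<and> c = nat \<bar>b i\<bar>" for c
      using that le assms(3) by (metis antisym)
  qed
qed

text \<open>The term at \<open>j\<close> and the rest of the sum have opposite signs and size at
  most \<open>\<bar>b j\<bar> * m\<close>, so the total is a multiple of \<open>p\<close> of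
  absolute value below \<open>p\<close>.\<close>

lemma dominant_eq_no_wraparound:
  fixes y :: "nat \<Rightarrow> int"
  assumes "finite V" "balanced_eq V b" "dominant_index V b j"
    and y: "\<And>i. i \<in> V \<Longrightarrow> 0 \<le> y i \<and> y i \<le> m"
    and lt: "\<bar>b j\<bar> * m < p" and cong: "[(\<Sum>i\<in>V. b i * y i) = 0] (mod p)"
  shows "(\<Sum>i\<in>V. b i * y i) = 0"
proof -
  have j: "j \<in> V" using assms(3) by (simp add: dominant_index_def)
  define s where "s = (\<Sum>i\<in>V - {j}. b i * y i)"
  have sum: "(\<Sum>i\<in>V. b i * y i) = b j * y j + s"
    unfolding s_def using assms(1) j by (rule sum.remove)
  have bj: "\<bar>b j * y j\<bar> \<le> \<bar>b j\<bar> * m"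
    using y[OF j] by (simp add: abs_mult mult_left_mono)
  have "\<bar>s\<bar> \<le> (\<Sum>i\<in>V - {j}. \<bar>b i\<bar> * m)"
    unfolding s_def using y
    by (intro order_trans[OF sum_abs] sum_mono) (auto simp: abs_mult intro!: mult_left_mono)
  then have s: "\<bar>s\<bar> \<le> \<bar>b j\<bar> * m"
    using balanced_sum_abs_eq[OF assms(1-3)] by (simp flip: sum_distrib_right)
  from assms(3) consider "b j > 0" "\<forall>i\<in>V - {j}. b i \<le> 0" | "b j < 0" "\<forall>i\<in>V - {j}. b i \<ge> 0"
    unfolding dominant_index_def by blast
  \<comment> \<open>The signs save a factor 2: the triangle inequality alone would bound the total
    only by 2 |b j| m.\<close>
  then have "b j * y j \<ge> 0 \<and> s \<le> 0 \<or> b j * y j \<le> 0 \<and> s \<ge> 0"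
  proof cases
    case 1
    then show ?thesis unfolding s_def using y j
      by (auto intro!: disjI1 sum_nonpos mult_nonneg_nonneg mult_nonpos_nonneg)
  next
    case 2
    then show ?thesis unfolding s_def using y j
      by (auto intro!: disjI2 sum_nonneg mult_nonneg_nonneg mult_nonpos_nonneg)
  qed
  then have "\<bar>b j * y j + s\<bar> < p" using bj s lt by linarith
  moreover have "p dvd b j * y j + s" using cong sum by (simp add: cong_0_iff)
  ultimately show ?thesis using sum by (metis zdvd_not_zless dvd_abs_iff abs_ge_zero order_le_less abs_0_eq)
qed

text \<open>
  Strict convexity of the sphere: by balancedness \<open>\<Sum>\<^sub>i b\<^sub>i \<bar>x\<^sub>i - x\<^sub>j\<bar>\<^sup>2 = - 2 (\<Sum>\<^sub>i b\<^sub>i x\<^sub>i) \<cdot> x\<^sub>j = 0\<close>,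
  and the nonzero terms of the left-hand side all have the same sign.
\<close>

lemma dominant_eq_constant_on_sphere:
  fixes x :: "nat \<Rightarrow> nat \<Rightarrow> int"
  assumes "finite V" "balanced_eq V b" "dominant_index V b j"
    and R: "\<And>i. i \<in> V \<Longrightarrow> (\<Sum>t<n. (x i t)\<^sup>2) = R"
    and sol: "\<And>t. t < n \<Longrightarrow> (\<Sum>i\<in>V. b i * x i t) = 0"
    and i: "i \<in> V" "b i \<noteq> 0" and t: "t < n"
  shows "x i t = x j t"
proof -
  have j: "j \<in> V" using assms(3) by (simp add: dominant_index_def)
  define d where "d i = (\<Sum>t<n. (x i t - x j t)\<^sup>2)" for i
  have d0: "d i \<ge> 0" for i unfolding d_def by (intro sum_nonneg) auto
  \<comment> \<open>Both squared norms are \<open>R\<close>; the sphere enters only here.\<close>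
  have d: "d i = 2 * R - 2 * (\<Sum>t<n. x i t * x j t)" if "i \<in> V" for i
    using R[OF that] R[OF j]
    by (simp add: d_def power2_diff sum.distrib sum_subtractf sum_distrib_left mult.assoc)
  have "(\<Sum>i\<in>V. b i * d i) = (\<Sum>i\<in>V. b i * (2 * R) - 2 * (\<Sum>t<n. b i * x i t * x j t))"
    by (intro sum.cong) (auto simp: d algebra_simps sum_distrib_left)
  also have "\<dots> = (\<Sum>i\<in>V. b i) * (2 * R) - 2 * (\<Sum>t<n. (\<Sum>i\<in>V. b i * x i t) * x j t)"
    by (simp add: sum_subtractf sum_distrib_right sum_distrib_left sum.swap[of _ V])
  also have "\<dots> = 0" using sol assms(2) by (simp add: balanced_eq_def)
  finally have "(\<Sum>i\<in>V. b i * d i) = 0" .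
  moreover have "d j = 0" by (simp add: d_def)
  ultimately have s0: "(\<Sum>i\<in>V - {j}. b i * d i) = 0"
    using sum.remove[OF assms(1) j, of "\<lambda>i. b i * d i"] by simp
  have "d i = 0"
  proof (cases "i = j")
    case False
    from assms(3) consider "\<forall>i\<in>V - {j}. b i \<le> 0" | "\<forall>i\<in>V - {j}. b i \<ge> 0"
      unfolding dominant_index_def by blast
    then have "\<forall>i\<in>V - {j}. b i * d i = 0"
    proof cases
      case 1
      moreover have "(\<Sum>i\<in>V - {j}. - (b i * d i)) = 0" using s0 by (simp add: sum_negf)
      ultimately show ?thesis
        using assms(1) d0 by (subst (asm) sum_nonneg_eq_0_iff) (auto simp: mult_nonpos_nonneg)
    next
      case 2
      then show ?thesis
        using s0 assms(1) d0 by (subst (asm) sum_nonneg_eq_0_iff) auto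
    qed
    then show ?thesis using i False by auto
  qed (simp add: \<open>d j = 0\<close>)
  then have "\<forall>t\<in>{..<n}. (x i t - x j t)\<^sup>2 = 0"
    unfolding d_def by (subst (asm) sum_nonneg_eq_0_iff) auto
  then show ?thesis using t by simp
qed

section \<open>Hypergraph components and the reduced system\<close>

lemma wf_system_reduce:
  assumes "wf_system S" "subsystem T S"
  shows "wf_system (reduce S T)"
  using assms by (auto simp: wf_system_def reduce_def reduce_eq_def subsystem_def intro!: sum.neutral)

lemma component_subset_vars:
  assumes "i \<in> vars T"
  shows "component T i \<subseteq> vars T"
proof
  fix j assume "j \<in> component T i"
  then have "(i, j) \<in> (hyp_adj T)\<^sup>*" by (simp add: component_def)
  then show "j \<in> vars T"
    using assms by induction (auto simp: hyp_adj_def edge_def)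
qed

text \<open>Lets an assignment constant on components be read off at representatives. It covers the
  kept variables too, since the reflexive closure puts \<open>i\<close> into its own
  component.\<close>

lemma new_var_in_component:
  assumes "finite (vars T)" "i \<in> vars T"
  shows "new_var T i \<in> component T i"
proof (cases "i \<in> hyp_verts T")
  case True
  have "finite (component T i)" "i \<in> component T i"
    using component_subset_vars[OF assms(2)] assms(1) finite_subset by (auto simp: component_def)
  then have "Min (component T i) \<in> component T i" by (intro Min_in) auto
  then show ?thesis using True by (simp add: new_var_def)
qed (simp add: new_var_def component_def)

lemma eq_on_component:
  assumes "\<And>b i j. b \<in> eqs T \<Longrightarrow> i \<in> edge T b \<Longrightarrow> j \<in> edge T b \<Longrightarrow> x i = x j"
    and "j \<in> component T i"
  shows "x i = x j"
proof -
  have "(i, j) \<in> (hyp_adj T)\<^sup>*" using assms(2) by (simp add: component_def)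
  then show ?thesis
  proof induction
    case (step j l)
    then obtain b where "b \<in> eqs T" "j \<in> edge T b" "l \<in> edge T b" by (auto simp: hyp_adj_def)
    then have "x j = x l" by (rule assms(1))
    then show ?case using step by simp
  qed simp
qed

text \<open>Group the right-hand sum by the value of \<open>new_var\<close>; \<open>y\<close> is
  constant on each group and factors out of the collected coefficients.\<close>

lemma sum_reduce_eq:
  assumes "finite (vars T)" and "\<And>i. i \<in> vars T \<Longrightarrow> y (new_var T i) = y i"
  shows "(\<Sum>v\<in>new_var T ` vars T. reduce_eq T b v * y v) = (\<Sum>i\<in>vars T. b i * y i)"
proof -
  have "(\<Sum>v\<in>new_var T ` vars T. reduce_eq T b v * y v)
      = (\<Sum>v\<in>new_var T ` vars T. \<Sum>i\<in>{i \<in> vars T. new_var T i = v}. b i * y i)"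
    unfolding reduce_eq_def sum_distrib_right
    by (intro sum.cong refl) (use assms(2) in auto)
  also have "\<dots> = (\<Sum>i\<in>vars T. b i * y i)"
    using assms(1) by (rule sum.image_gen[symmetric])
  finally show ?thesis .
qed

text \<open>Freeness is pulled back along one reduction, for the same set. Representatives are old
  indices, so the same \<open>x\<close> serves as the assignment for the reduced system.\<close>

lemma strongly_free_reduce:
  assumes wf: "wf_system S" and sub: "subsystem T S" and dom: "dominant T"
    and coeff: "dominant_coeff T * m < p"
    and free: "strongly_free (reduce S T) p n (grid_sphere m n R)"
  shows "strongly_free S p n (grid_sphere m n R)"
  unfolding strongly_free_def
proof (intro allI impI, elim conjE)
  fix x assume A: "\<forall>i\<in>vars S. x i \<in> grid_sphere m n R" and sol: "solution_mod S p n x"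
  have V: "vars T = vars S" and TS: "eqs T \<subseteq> eqs S" using sub by (auto simp: subsystem_def)
  have fin: "finite (vars T)" "finite (eqs T)"
    using wf V TS finite_subset by (auto simp: wf_system_def)
  have edge_const: "x i = x i'" if b: "b \<in> eqs T" and i: "i \<in> edge T b" "i' \<in> edge T b" for b i i'
  proof -
    from dom b obtain j where bal: "balanced_eq (vars T) b" and j: "dominant_index (vars T) b j"
      unfolding dominant_def dominant_eq_def by blast
    have "dominant_coeff_eq (vars T) b \<le> dominant_coeff T"
      unfolding dominant_coeff_def using fin b by (intro Max_ge) auto
    then have "\<bar>b j\<bar> \<le> int (dominant_coeff T)"
      using dominant_coeff_eq_eq[OF fin(1) bal j] by simp
    then have "\<bar>b j\<bar> * int m \<le> int (dominant_coeff T * m)" by (simp add: mult_right_mono)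
    then have lt: "\<bar>b j\<bar> * int m < int p" using coeff by linarith
    have zero: "(\<Sum>i\<in>vars T. b i * x i t) = 0" if "t < n" for t
      using fin(1) bal j _ lt
    proof (rule dominant_eq_no_wraparound)
      show "0 \<le> x i t \<and> x i t \<le> int m" if "i \<in> vars T" for i
        using A V that \<open>t < n\<close> by (auto simp: grid_sphere_def PiE_iff)
      show "[(\<Sum>i\<in>vars T. b i * x i t) = 0] (mod int p)"
        using sol b TS V \<open>t < n\<close> by (auto simp: solution_mod_def)
    qed
    have R: "(\<Sum>t<n. (x i t)\<^sup>2) = R" if "i \<in> vars T" for i
      using A V that by (simp add: grid_sphere_def)
    \<comment> \<open>Each vertex of the edge is compared with the dominant index
      \<open>j\<close>.\<close>
    have eq: "x i t = x j t" if "i \<in> edge T b" "t < n" for i t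
      using that by (intro dominant_eq_constant_on_sphere[OF fin(1) bal j R zero]) (auto simp: edge_def)
    \<comment> \<open>Both functions take the default value off \<open>{..<n}\<close>, so agreement
      in the \<open>n\<close> coordinates gives equality.\<close>
    have "x i \<in> extensional {..<n}" "x i' \<in> extensional {..<n}"
      using A V i by (auto simp: grid_sphere_def PiE_iff edge_def)
    then show ?thesis
      by (rule extensionalityI) (use eq i in auto)
  qed
  have new: "x (new_var T i) = x i" "new_var T i \<in> vars S" if "i \<in> vars S" for i
  proof -
    have "i \<in> vars T" using that V by simp
    note comp = new_var_in_component[OF fin(1) this] component_subset_vars[OF this]
    show "new_var T i \<in> vars S" using comp V by auto
    show "x (new_var T i) = x i"
      using eq_on_component[of T x, OF edge_const comp(1)] by (rule sym)
  qed
  have "solution_mod (reduce S T) p n x"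
    unfolding solution_mod_def
  proof (intro ballI allI impI)
    fix c t assume "c \<in> eqs (reduce S T)" and t: "t < n"
    then obtain b where b: "b \<in> eqs S" "c = reduce_eq T b" by (auto simp: reduce_def)
    have "(\<Sum>v\<in>vars (reduce S T). c v * x v t) = (\<Sum>i\<in>vars S. b i * x i t)"
      using sum_reduce_eq[of T "\<lambda>i. x i t" b] fin new V b by (simp add: reduce_def)
    then show "[(\<Sum>v\<in>vars (reduce S T). c v * x v t) = 0] (mod int p)"
      using sol b t by (simp add: solution_mod_def)
  qed
  moreover have "\<forall>v\<in>vars (reduce S T). x v \<in> grid_sphere m n R"
    using A new by (auto simp: reduce_def)
  ultimately have const: "\<forall>i\<in>vars (reduce S T). \<forall>j\<in>vars (reduce S T). x i = x j"
    using free unfolding strongly_free_def by blast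
  show "\<forall>i\<in>vars S. \<forall>j\<in>vars S. x i = x j"
  proof (intro ballI)
    fix i j assume ij: "i \<in> vars S" "j \<in> vars S"
    then have "new_var T i \<in> vars (reduce S T)" "new_var T j \<in> vars (reduce S T)"
      by (simp_all add: reduce_def)
    then have "x (new_var T i) = x (new_var T j)" using const by blast
    then show "x i = x j" using new(1) ij by simp
  qed
qed

section \<open>Assembling the lower bound\<close>

lemma dominant_coeff_pos:
  assumes "finite (vars T)" "finite (eqs T)" "eqs T \<noteq> {}" "dominant T"
  shows "dominant_coeff T > 0"
proof -
  obtain b j where b: "b \<in> eqs T" "balanced_eq (vars T) b" and j: "dominant_index (vars T) b j"
    using assms(3,4) unfolding dominant_def dominant_eq_def by blast
  have "0 < nat \<bar>b j\<bar>" using j by (auto simp: dominant_index_def)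
  also have "\<dots> = dominant_coeff_eq (vars T) b"
    using dominant_coeff_eq_eq[OF assms(1) b(2) j] by simp
  also have "\<dots> \<le> dominant_coeff T"
    unfolding dominant_coeff_def using assms(2) b(1) by (intro Max_ge) auto
  finally show ?thesis .
qed

lemma card_le_ex_size:
  assumes "A \<subseteq> Fp_space p n" "strongly_free S p n A"
  shows "card A \<le> ex_size S n p"
proof -
  have "finite (Fp_space p n)" unfolding Fp_space_def by (intro finite_PiE) auto
  then show ?thesis unfolding ex_size_def using assms by (intro Max_ge) auto
qed

theorem theoremD:
  fixes S :: lin_system and Ss Ts :: "nat \<Rightarrow> lin_system"
    and r k b p :: nat and \<epsilon> :: real
  assumes "wf_system S" and "vars S = {1..r}"
    and "balanced S" and "irreducible_system S"
    and "Ss 0 = S"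
    and "\<And>i. i \<le> k \<Longrightarrow> dominant_reduction (Ss i) (Ts i) (Ss (Suc i))"
    and "empty_system_one (Ss (Suc k))"
    and "b = Max ((\<lambda>i. dominant_coeff (Ts i)) ` {..k})"
    and "prime p" and "p > b"
    and "0 < \<epsilon>" and "\<epsilon> \<le> 1"
  shows "\<exists>n0. \<forall>n\<ge>n0.
    real (ex_size S n p) \<ge> ((1 - \<epsilon>) * of_int \<lfloor>(real p + real b - 1) / real b\<rfloor>) ^ n"
proof -
  have red: "subsystem (Ts i) (Ss i)" "dominant (Ts i)" "Ss (Suc i) = reduce (Ss i) (Ts i)"
    if "i \<le> k" for i
    using assms(6)[OF that] by (auto simp: dominant_reduction_def)
  have wf: "wf_system (Ss i)" if "i \<le> Suc k" for i
    using that by (induction i) (use assms(1,5) red wf_system_reduce in auto)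
  have le_b: "dominant_coeff (Ts i) \<le> b" if "i \<le> k" for i
    unfolding assms(8) using that by (intro Max_ge) auto
  \<comment> \<open>The sequence has at least one reduction and its subsystem is nonempty; hence
    division by \<open>b\<close> is genuine.\<close>
  have "dominant_coeff (Ts 0) > 0"
    using red[of 0] wf[of 0] finite_subset
    by (intro dominant_coeff_pos) (auto simp: subsystem_def wf_system_def)
  then have b: "b > 0" using le_b[of 0] by simp
  \<comment> \<open>The largest \<open>m\<close> with \<open>b * m < p\<close>; as \<open>b\<close>
    bounds every dominant coefficient in the sequence, one \<open>m\<close> serves all
    reductions.\<close>
  define m where "m = (p - 1) div b"
  have "b * m \<le> p - 1" unfolding m_def by (rule times_div_less_eq_dividend)
  then have bm: "b * m < p" using assms(10) by linarith
  have "m \<le> p - 1" unfolding m_def by (rule div_le_dividend)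
  then have mp: "m < p" using assms(10) by linarith
  have free: "strongly_free S p n (grid_sphere m n R)" for n R
  proof -
    \<comment> \<open>Downward induction from the final system, where a single variable makes every
      set strongly free.\<close>
    have "strongly_free (Ss i) p n (grid_sphere m n R)" if "i \<le> Suc k" for i
      using that
    proof (induction rule: inc_induct)
      case base
      then show ?case
        using assms(7) by (auto simp: strongly_free_def empty_system_one_def card_1_singleton_iff)
    next
      case (step i)
      then have i: "i \<le> k" by simp
      have "dominant_coeff (Ts i) * m \<le> b * m" using le_b[OF i] by (rule mult_right_mono) simp
      then show ?case
        using strongly_free_reduce[OF wf red(1,2)] red(3) step i bm by (metis le_Suc_eq le_less_trans)
    qed
    from this[of 0] show ?thesis using assms(5) by simp
  qed
  obtain n0 where n0: "\<And>n. n \<ge> n0 \<Longrightarrow> (1 - \<epsilon>) ^ n * (real n * (real m)\<^sup>2 + 1) \<le> 1"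
    using eventually_power_times_linear_le_1[OF assms(11,12)] by blast
  have "((1 - \<epsilon>) * (real m + 1)) ^ n \<le> real (ex_size S n p)" if "n \<ge> n0" for n
  proof -
    \<comment> \<open>The radius may vary with \<open>n\<close>, as \<open>free\<close> holds for
      every \<open>R\<close>.\<close>
    obtain R where R: "(m + 1) ^ n \<le> card (grid_sphere m n R) * (n * m\<^sup>2 + 1)"
      using large_grid_sphere by blast
    have "grid_sphere m n R \<subseteq> Fp_space p n"
      unfolding grid_sphere_def Fp_space_def
      using mp by (intro order_trans[OF Collect_restrict] PiE_mono) auto
    then have "card (grid_sphere m n R) \<le> ex_size S n p"
      using free by (rule card_le_ex_size)
    then have "card (grid_sphere m n R) * (n * m\<^sup>2 + 1) \<le> ex_size S n p * (n * m\<^sup>2 + 1)"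
      by (rule mult_right_mono) simp
    with R have "(m + 1) ^ n \<le> ex_size S n p * (n * m\<^sup>2 + 1)" by linarith
    then have "real ((m + 1) ^ n) \<le> real (ex_size S n p * (n * m\<^sup>2 + 1))"
      by (simp only: of_nat_le_iff)
    then have "(real m + 1) ^ n \<le> real (ex_size S n p) * (real n * (real m)\<^sup>2 + 1)"
      by (simp add: algebra_simps)
    \<comment> \<open>The factor is nonnegative since \<open>\<epsilon> \<le> 1\<close>; for
      \<open>n \<ge> n0\<close> it absorbs n m^2 + 1.\<close>
    then have "(1 - \<epsilon>) ^ n * (real m + 1) ^ n
        \<le> (1 - \<epsilon>) ^ n * (real (ex_size S n p) * (real n * (real m)\<^sup>2 + 1))"
      using assms(12) by (intro mult_left_mono) auto
    also have "\<dots> = real (ex_size S n p) * ((1 - \<epsilon>) ^ n * (real n * (real m)\<^sup>2 + 1))" by simp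
    also have "\<dots> \<le> real (ex_size S n p) * 1" using n0[OF that] by (intro mult_left_mono) auto
    finally show ?thesis by (simp add: power_mult_distrib)
  qed
  moreover have "real_of_int \<lfloor>(real p + real b - 1) / real b\<rfloor> = real m + 1"
    using floor_div_eq[of b p] b assms(10) by (simp add: m_def)
  ultimately show ?thesis by auto
qed

end
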